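(* Let $X$ be a real Banach space with a basis $(b_i)_{i\in\omega}$. There exists an equivalent norm $|||\cdot|||$ on $X$ such that if $(X,|||\cdot|||)$ admits $|||\cdot|||$-normalized block bases $(x_m)_{m\in\omega}$ and $(y_n)_{n\in\omega}$ of $(b_i)_{i\in\omega}$ satisfying $$\lim_{m\to\infty}\lim_{n\to\infty}|||x_m+ y_n|||=\lim_{m\to\infty}\lim_{n\to\infty}|||x_m- y_n|||=2,$$ then $X$ contains an isomorph of $\ell_1$.
   Context: $\omega=\{0,1,2,\ldots\}$; $X$ is infinite dimensional and basis means Schauder basis. A block basis of $(b_i)$ is a sequence of non-zero vectors $y_k=\sum_{l=p_k}^{p_{k+1}-1}c_lb_l$ with $p_0<p_1<\cdots$ and real scalars $c_l$. *)

theory Defs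
  imports Complex_Main
begin

definition schauder_basis :: "(nat \<Rightarrow> 'a::real_normed_vector) \<Rightarrow> bool" where
  "schauder_basis b \<longleftrightarrow> (\<forall>x. \<exists>!a::nat \<Rightarrow> real. (\<lambda>n. a n *\<^sub>R b n) sums x)"

definition block_basis :: "(nat \<Rightarrow> 'a::real_vector) \<Rightarrow> (nat \<Rightarrow> 'a) \<Rightarrow> bool" where
  "block_basis b y \<longleftrightarrow>
    (\<exists>(p::nat \<Rightarrow> nat) (c::nat \<Rightarrow> real). strict_mono p \<and>
      (\<forall>k. y k = (\<Sum>l = p k..<p (Suc k). c l *\<^sub>R b l) \<and> y k \<noteq> 0))"

definition is_norm :: "('a::real_vector \<Rightarrow> real) \<Rightarrow> bool" where
  "is_norm N \<longleftrightarrow>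
    (\<forall>x. 0 \<le> N x) \<and> (\<forall>x. N x = 0 \<longleftrightarrow> x = 0) \<and>
    (\<forall>r x. N (r *\<^sub>R x) = \<bar>r\<bar> * N x) \<and>
    (\<forall>x y. N (x + y) \<le> N x + N y)"

definition equivalent_norm :: "('a::real_normed_vector \<Rightarrow> real) \<Rightarrow> bool" where
  "equivalent_norm N \<longleftrightarrow> is_norm N \<and>
    (\<exists>c>0. \<exists>C>0. \<forall>x. c * norm x \<le> N x \<and> N x \<le> C * norm x)"

definition normalized :: "('a \<Rightarrow> real) \<Rightarrow> (nat \<Rightarrow> 'a) \<Rightarrow> bool" where
  "normalized N x \<longleftrightarrow> (\<forall>k. N (x k) = 1)"

text \<open>The iterated limit \<open>lim\<^sub>m lim\<^sub>n f m n\<close> exists and equals \<open>L\<close>;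
  the inner limit is required to exist for every \<open>m\<close>.\<close>

definition iterated_limit :: "(nat \<Rightarrow> nat \<Rightarrow> real) \<Rightarrow> real \<Rightarrow> bool" where
  "iterated_limit f L \<longleftrightarrow>
    (\<exists>g. (\<forall>m. (\<lambda>n. f m n) \<longlonglongrightarrow> g m) \<and> g \<longlonglongrightarrow> L)"

definition ell1 :: "(nat \<Rightarrow> real) set" where
  "ell1 = {a. summable (\<lambda>n. \<bar>a n\<bar>)}"

definition ell1_norm :: "(nat \<Rightarrow> real) \<Rightarrow> real" where
  "ell1_norm a = (\<Sum>n. \<bar>a n\<bar>)"

text \<open>A linear isomorphism of \<open>ell1\<close> onto the subspace \<open>S\<close>, bounded with bounded inverse;
  the lower estimate also yields injectivity and closedness of \<open>S\<close>.\<close>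

definition isomorphic_to_ell1 :: "'a::real_normed_vector set \<Rightarrow> bool" where
  "isomorphic_to_ell1 S \<longleftrightarrow>
    (\<exists>T::(nat \<Rightarrow> real) \<Rightarrow> 'a.
      (\<forall>a\<in>ell1. \<forall>d\<in>ell1. T (\<lambda>n. a n + d n) = T a + T d) \<and>
      (\<forall>r. \<forall>a\<in>ell1. T (\<lambda>n. r * a n) = r *\<^sub>R T a) \<and>
      T ` ell1 = S \<and>
      (\<exists>c>0. \<exists>C>0. \<forall>a\<in>ell1. c * ell1_norm a \<le> norm (T a) \<and> norm (T a) \<le> C * ell1_norm a))"

end

theory Submission
  imports Defs "HOL-Analysis.Elementary_Normed_Spaces" "HOL-Library.Diagonal_Subsequence"
begin

text \<open>The renorming of Odell and Schlumprecht: for a dense sequence \<open>(c\<^sub>k)\<close> put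
  \<open>N x = (\<Sum>k. p\<^sub>k (\<parallel>\<parallel>x\<parallel> c\<^sub>k + x\<parallel> + \<parallel>\<parallel>x\<parallel> c\<^sub>k - x\<parallel>))\<close>. If \<open>N\<close> is asymptotically additive on
  \<open>x\<^sub>m, y\<^sub>n\<close>, then so is every summand; after normalizing in the original norm, this gives
  \<open>\<parallel>(\<alpha> + \<beta>) c + \<alpha> x\<^sub>m + \<beta> y\<^sub>n\<parallel> \<approx> \<alpha> \<parallel>c + x\<^sub>m\<parallel> + \<beta> \<parallel>c + y\<^sub>n\<parallel>\<close> for all \<open>c\<close> and all \<open>\<alpha>, \<beta> \<ge> 0\<close>.
  Let \<open>\<sigma> c\<close> and \<open>\<tau> c\<close> be the limits of \<open>\<parallel>c + x\<^sub>m\<parallel>\<close> and \<open>\<parallel>c + y\<^sub>n\<parallel>\<close> along subsequences. The case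
  \<open>\<alpha> = \<beta> = 1\<close> and the triangle inequality yield \<open>\<sigma> c + \<tau> c \<le> \<sigma> (c + d) + \<tau> (c - d)\<close>, which forces
  \<open>\<sigma> = \<tau>\<close>; the same argument with \<open>- y\<^sub>n\<close> makes \<open>\<sigma>\<close> even. Hence, writing \<open>T s c\<close> for the limit of
  \<open>\<parallel>c + s x\<^sub>n\<parallel>\<close>, asymptotically \<open>T \<beta> (c + \<alpha> x\<^sub>m) \<ge> T (\<bar>\<alpha>\<bar> + \<beta>) c\<close>, so that terms of \<open>(x\<^sub>m)\<close> can be
  chosen one after the other keeping a lower \<open>\<ell>\<^sub>1\<close>-estimate.\<close>

section \<open>Separability of a space with a basis\<close>

lemma one_plus_norm_pos: "0 < 1 + norm x"
  by (simp add: add_pos_nonneg)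

text \<open>Truncate the basis expansion, then replace the coefficients by nearby rationals. The
  finite lists of rationals are countable, and \<open>from_nat\<close> enumerates them.\<close>

lemma schauder_basis_separable:
  fixes b :: "nat \<Rightarrow> 'a::real_normed_vector"
  assumes "schauder_basis b"
  obtains c :: "nat \<Rightarrow> 'a" where "\<And>x e. 0 < e \<Longrightarrow> \<exists>k. norm (x - c k) < e"
proof -
  define c where "c k = (let l = (from_nat k :: rat list) in \<Sum>i<length l. of_rat (l ! i) *\<^sub>R b i)" for k
  have "\<exists>k. norm (x - c k) < e" if e: "0 < e" for x :: 'a and e :: real
  proof -
  obtain a where "(\<lambda>n. a n *\<^sub>R b n) sums x"
    using assms unfolding schauder_basis_def by blast
  then have "(\<lambda>n. \<Sum>i<n. a i *\<^sub>R b i) \<longlonglongrightarrow> x"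
    by (simp add: sums_def)
  with e obtain n where n: "norm ((\<Sum>i<n. a i *\<^sub>R b i) - x) < e / 2"
    using LIMSEQ_D[of _ x "e / 2"] by (meson half_gt_zero order_refl)
  \<comment> \<open>The tolerance makes each of the \<open>n\<close> coefficient errors cost at most
    \<open>e / (2 * (n + 1))\<close>, so that their sum stays strictly below \<open>e / 2\<close>.
    Adding 1 to \<open>norm (b i)\<close> keeps the denominator positive.\<close>
  define d where "d i = e / (2 * (real n + 1) * (1 + norm (b i)))" for i
  have d0: "0 < d i" for i
    unfolding d_def by (intro divide_pos_pos mult_pos_pos one_plus_norm_pos e) simp_all
  have "\<exists>q. a i - d i < of_rat q \<and> of_rat q < a i" for i
    using of_rat_dense[of "a i - d i" "a i"] d0[of i] by auto
  then obtain q where q: "\<And>i. a i - d i < of_rat (q i)" "\<And>i. of_rat (q i) < a i"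
    by metis
  define l where "l = map q [0..<n]"
  have ck: "c (to_nat l) = (\<Sum>i<n. of_rat (q i) *\<^sub>R b i)"
    by (simp add: c_def l_def)
  have "norm ((\<Sum>i<n. a i *\<^sub>R b i) - c (to_nat l)) = norm (\<Sum>i<n. (a i - of_rat (q i)) *\<^sub>R b i)"
    by (simp add: ck sum_subtractf scaleR_left_diff_distrib)
  also have "\<dots> \<le> (\<Sum>i<n. e / (2 * (real n + 1)))"
  proof (rule sum_norm_le)
    fix i
    have "norm ((a i - of_rat (q i)) *\<^sub>R b i) \<le> d i * norm (b i)"
      using q[of i] by (auto intro!: mult_right_mono)
    also have "\<dots> \<le> d i * (1 + norm (b i))"
      using d0[of i] by (intro mult_left_mono) auto
    also have "\<dots> = e / (2 * (real n + 1))"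
      using add_pos_nonneg[OF zero_less_one norm_ge_zero, of "b i"] by (simp add: d_def)
    finally show "norm ((a i - of_rat (q i)) *\<^sub>R b i) \<le> e / (2 * (real n + 1))" .
  qed
  also have "\<dots> < e / 2"
    using e by (simp add: field_simps)
  finally have "norm ((\<Sum>i<n. a i *\<^sub>R b i) - c (to_nat l)) < e / 2" .
  with n have "norm (x - c (to_nat l)) < e"
    using norm_triangle_ineq4[of "(\<Sum>i<n. a i *\<^sub>R b i) - c (to_nat l)" "(\<Sum>i<n. a i *\<^sub>R b i) - x"]
    by simp
  then show ?thesis ..
  qed
  with that show thesis .
qed

section \<open>The equivalent norm\<close>

text \<open>The factor \<open>norm x\<close> on the centre makes the expression positively
  homogeneous, and the two signs make it even.\<close>

definition os_norm :: "'a::real_normed_vector \<Rightarrow> 'a \<Rightarrow> real" where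
  "os_norm c x = norm (norm x *\<^sub>R c + x) + norm (norm x *\<^sub>R c - x)"

text \<open>A convex even function of \<open>s\<close> is increasing on \<open>s \<ge> 0\<close>.\<close>

lemma norm_add_plus_norm_diff_mono:
  fixes c x :: "'a::real_normed_vector"
  assumes "0 \<le> s" "s \<le> t"
  shows "norm (s *\<^sub>R c + x) + norm (s *\<^sub>R c - x) \<le> norm (t *\<^sub>R c + x) + norm (t *\<^sub>R c - x)"
proof (cases "t = 0")
  case True
  then show ?thesis using assms by simp
next
  case False
  with assms have t: "t > 0" by simp
  \<comment> \<open>The weights \<open>l\<close> and \<open>1 - l\<close> express \<open>s\<close>
    as a convex combination of \<open>t\<close> and \<open>- t\<close>.\<close>
  define l where "l = (1 + s / t) / 2"
  have l: "0 \<le> l" "0 \<le> 1 - l" and st: "l * t - (1 - l) * t = s"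
    using assms t by (auto simp: l_def field_simps)
  have sc: "s *\<^sub>R c = (l * t) *\<^sub>R c - ((1 - l) * t) *\<^sub>R c"
    by (simp only: st flip: scaleR_left_diff_distrib)
  have "s *\<^sub>R c + x = l *\<^sub>R (t *\<^sub>R c + x) - (1 - l) *\<^sub>R (t *\<^sub>R c - x)"
    unfolding sc by (simp add: algebra_simps)
  then have 1: "norm (s *\<^sub>R c + x) \<le> l * norm (t *\<^sub>R c + x) + (1 - l) * norm (t *\<^sub>R c - x)"
    using l norm_triangle_ineq4[of "l *\<^sub>R (t *\<^sub>R c + x)" "(1 - l) *\<^sub>R (t *\<^sub>R c - x)"] by simp
  have "s *\<^sub>R c - x = l *\<^sub>R (t *\<^sub>R c - x) - (1 - l) *\<^sub>R (t *\<^sub>R c + x)"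
    unfolding sc by (simp add: algebra_simps)
  then have 2: "norm (s *\<^sub>R c - x) \<le> l * norm (t *\<^sub>R c - x) + (1 - l) * norm (t *\<^sub>R c + x)"
    using l norm_triangle_ineq4[of "l *\<^sub>R (t *\<^sub>R c - x)" "(1 - l) *\<^sub>R (t *\<^sub>R c + x)"] by simp
  from add_mono[OF 1 2] show ?thesis by (simp add: algebra_simps)
qed

text \<open>Since \<open>norm (x + y) \<le> norm x + norm y\<close>, monotonicity in the factor of
  \<open>c\<close> bounds \<open>os_norm c (x + y)\<close> by the expression with
  \<open>norm x + norm y\<close>. Its minus half is subadditive, so the defect of the plus half
  alone is controlled by the whole.\<close>

lemma os_norm_defect:
  "norm (norm x *\<^sub>R c + x) + norm (norm y *\<^sub>R c + y) - norm ((norm x + norm y) *\<^sub>R c + x + y)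
    \<le> os_norm c x + os_norm c y - os_norm c (x + y)"
proof -
  have "os_norm c (x + y) \<le> norm ((norm x + norm y) *\<^sub>R c + (x + y)) + norm ((norm x + norm y) *\<^sub>R c - (x + y))"
    unfolding os_norm_def
    by (rule norm_add_plus_norm_diff_mono) (auto simp: norm_triangle_ineq)
  moreover have "norm ((norm x + norm y) *\<^sub>R c - (x + y)) \<le> norm (norm x *\<^sub>R c - x) + norm (norm y *\<^sub>R c - y)"
    using norm_triangle_ineq[of "norm x *\<^sub>R c - x" "norm y *\<^sub>R c - y"] by (simp add: algebra_simps)
  ultimately show ?thesis by (simp add: os_norm_def add.assoc)
qed

lemma os_norm_triangle: "os_norm c (x + y) \<le> os_norm c x + os_norm c y"
  using os_norm_defect[of x c y] norm_triangle_ineq[of "norm x *\<^sub>R c + x" "norm y *\<^sub>R c + y"]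
  by (simp add: algebra_simps)

lemma os_norm_ge: "2 * norm x \<le> os_norm c x"
  using norm_triangle_ineq4[of "norm x *\<^sub>R c + x" "norm x *\<^sub>R c - x"]
  by (simp add: os_norm_def flip: scaleR_2)

lemma os_norm_le: "os_norm c x \<le> 2 * (1 + norm c) * norm x"
  using norm_triangle_ineq[of "norm x *\<^sub>R c" x] norm_triangle_ineq4[of "norm x *\<^sub>R c" x]
  by (simp add: os_norm_def algebra_simps)

lemma os_norm_minus: "os_norm c (- x) = os_norm c x"
  by (simp add: os_norm_def)

lemma os_norm_scaleR: "os_norm c (r *\<^sub>R x) = \<bar>r\<bar> * os_norm c x"
proof -
  have *: "os_norm c (t *\<^sub>R x) = t * os_norm c x" if "t \<ge> 0" for t
  proof -
    have "norm (t *\<^sub>R x) *\<^sub>R c + t *\<^sub>R x = t *\<^sub>R (norm x *\<^sub>R c + x)"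
      "norm (t *\<^sub>R x) *\<^sub>R c - t *\<^sub>R x = t *\<^sub>R (norm x *\<^sub>R c - x)"
      using that by (simp_all add: algebra_simps)
    then show ?thesis
      unfolding os_norm_def using that by (simp only: norm_scaleR abs_of_nonneg distrib_left)
  qed
  show ?thesis
    using *[of r] *[of "- r"] os_norm_minus[of c "r *\<^sub>R x"] by (cases "r \<ge> 0") auto
qed

text \<open>Dividing by \<open>1 + norm (c k)\<close> cancels the growth in
  \<open>os_norm_le\<close>, so a geometric series dominates whatever the sequence \<open>c\<close>
  is.\<close>

definition os_sum :: "(nat \<Rightarrow> 'a::real_normed_vector) \<Rightarrow> 'a \<Rightarrow> real" where
  "os_sum c x = (\<Sum>k. (1/2)^k / (1 + norm (c k)) * os_norm (c k) x)"

lemma os_norm_nonneg: "0 \<le> os_norm c x"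
  using os_norm_ge[of x c] norm_ge_zero[of x] by linarith

lemma os_sum_term_le: "(1/2)^k / (1 + norm c) * os_norm c x \<le> 2 * norm x * (1/2)^k"
proof -
  have *: "u \<noteq> 0 \<Longrightarrow> p / u * (2 * u * n) = 2 * n * p" for p u n :: real
    by simp
  have "(1/2)^k / (1 + norm c) * os_norm c x \<le> (1/2)^k / (1 + norm c) * (2 * (1 + norm c) * norm x)"
    by (intro mult_left_mono os_norm_le) simp
  also have "\<dots> = 2 * norm x * (1/2)^k"
    using less_imp_neq[OF one_plus_norm_pos[of c], symmetric] by (simp only: * not_False_eq_True)
  finally show ?thesis .
qed

lemma os_sum_summable: "summable (\<lambda>k. (1/2)^k / (1 + norm (c k)) * os_norm (c k) x)"
proof (rule summable_comparison_test')
  show "summable (\<lambda>k. 2 * norm x * (1/2)^k)"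
    by (intro summable_mult summable_geometric) simp
  show "norm ((1/2)^n / (1 + norm (c n)) * os_norm (c n) x) \<le> 2 * norm x * (1/2)^n" for n
    using os_sum_term_le[of n "c n" x] by (simp add: os_norm_nonneg)
qed

lemma os_sum_le: "os_sum c x \<le> 4 * norm x"
proof -
  have "os_sum c x \<le> (\<Sum>k. 2 * norm x * (1/2)^k)"
    unfolding os_sum_def
    by (intro suminf_le os_sum_term_le os_sum_summable summable_mult summable_geometric) simp
  also have "\<dots> = 4 * norm x"
    by (subst suminf_mult) (auto simp: suminf_geometric)
  finally show ?thesis .
qed

lemma os_sum_ge: "2 / (1 + norm (c 0)) * norm x \<le> os_sum c x"
proof -
  have "2 / (1 + norm (c 0)) * norm x \<le> (1/2)^0 / (1 + norm (c 0)) * os_norm (c 0) x"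
    using os_norm_ge[of x "c 0"] by (simp add: divide_right_mono)
  also have "\<dots> \<le> os_sum c x"
    unfolding os_sum_def
    using sum_le_suminf[OF os_sum_summable, of "{0}" c x] by (simp add: os_norm_nonneg)
  finally show ?thesis .
qed

text \<open>The triangle inequality makes every termwise defect nonnegative, so a single one is at
  most their sum. This is how information on the new norm reaches each centre
  \<open>c k\<close>.\<close>

lemma os_sum_defect:
  "(1/2)^k / (1 + norm (c k)) * (os_norm (c k) x + os_norm (c k) y - os_norm (c k) (x + y))
    \<le> os_sum c x + os_sum c y - os_sum c (x + y)"
proof -
  let ?f = "\<lambda>k. (1/2)^k / (1 + norm (c k)) * (os_norm (c k) x + os_norm (c k) y - os_norm (c k) (x + y))"
  have s: "?f sums (os_sum c x + os_sum c y - os_sum c (x + y))"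
    unfolding os_sum_def distrib_left right_diff_distrib
    by (intro sums_diff sums_add summable_sums os_sum_summable)
  have "sum ?f {k} \<le> suminf ?f"
    by (rule sum_le_suminf[OF sums_summable[OF s]])
       (auto intro!: mult_nonneg_nonneg simp: os_norm_triangle)
  with sums_unique[OF s] show ?thesis by simp
qed

lemma equivalent_norm_os_sum: "equivalent_norm (os_sum c)"
proof -
  have tri: "os_sum c (x + y) \<le> os_sum c x + os_sum c y" for x y
  proof -
    have "0 \<le> (1/2)^0 / (1 + norm (c 0)) * (os_norm (c 0) x + os_norm (c 0) y - os_norm (c 0) (x + y))"
      by (intro mult_nonneg_nonneg) (auto simp: os_norm_triangle)
    with os_sum_defect[of 0 c x y] show ?thesis by linarith
  qed
  have hom: "os_sum c (r *\<^sub>R x) = \<bar>r\<bar> * os_sum c x" for r x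
    unfolding os_sum_def os_norm_scaleR
    by (subst suminf_mult[OF os_sum_summable, symmetric]) (simp add: mult_ac)
  have pos: "0 < 2 / (1 + norm (c 0))"
    by (simp add: one_plus_norm_pos)
  have nonneg: "0 \<le> os_sum c x" for x
    using os_sum_ge[of c x] mult_nonneg_nonneg[OF less_imp_le[OF pos] norm_ge_zero[of x]] by linarith
  have zero: "os_sum c x = 0 \<longleftrightarrow> x = 0" for x
    using os_sum_ge[of c x] os_sum_le[of c x] nonneg[of x] mult_pos_pos[OF pos, of "norm x"]
    by (cases "x = 0") auto
  show ?thesis
    unfolding equivalent_norm_def is_norm_def
  proof (intro conjI allI exI)
    show "0 < 2 / (1 + norm (c 0))" by fact
    show "(0::real) < 4" by simp
  qed (simp_all only: nonneg zero hom tri os_sum_ge os_sum_le)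
qed

section \<open>Iterated smallness of double sequences\<close>

text \<open>A one-sided substitute for an iterated limit 0 that does not presuppose inner limits. It
  therefore passes to dominated double sequences and to subsequences in either index.\<close>

definition iter_small :: "(nat \<Rightarrow> nat \<Rightarrow> real) \<Rightarrow> bool" where
  "iter_small E \<longleftrightarrow> (\<forall>e>0. \<forall>\<^sub>F m in sequentially. \<forall>\<^sub>F n in sequentially. E m n < e)"

lemma iter_smallD:
  "iter_small E \<Longrightarrow> 0 < e \<Longrightarrow> \<forall>\<^sub>F m in sequentially. \<forall>\<^sub>F n in sequentially. E m n < e"
  by (simp add: iter_small_def)

lemma iter_small_subseq:
  assumes "iter_small E" "strict_mono r" "strict_mono q"
  shows "iter_small (\<lambda>m n. E (r m) (q n))"
  unfolding iter_small_def
proof (intro allI impI)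
  fix e :: real
  assume "0 < e"
  have "\<forall>\<^sub>F m in sequentially. \<forall>\<^sub>F n in sequentially. E (r m) n < e"
    by (rule eventually_subseq[OF assms(2) iter_smallD[OF assms(1) \<open>0 < e\<close>]])
  then show "\<forall>\<^sub>F m in sequentially. \<forall>\<^sub>F n in sequentially. E (r m) (q n) < e"
    by eventually_elim (rule eventually_subseq[OF assms(3)])
qed

lemma iter_small_dominated:
  assumes "iter_small E" "\<And>m n. D m n \<le> E m n"
  shows "iter_small D"
  unfolding iter_small_def
proof (intro allI impI)
  fix e :: real
  assume "0 < e"
  from iter_smallD[OF assms(1) this]
  show "\<forall>\<^sub>F m in sequentially. \<forall>\<^sub>F n in sequentially. D m n < e"
    by (rule eventually_mono) (auto elim!: eventually_mono intro: le_less_trans[OF assms(2)])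
qed

lemma iter_small_inner_limit:
  assumes "iter_small E" "\<And>m. E m \<longlonglongrightarrow> g m" "0 < e"
  shows "\<forall>\<^sub>F m in sequentially. g m \<le> e"
  using iter_smallD[OF assms(1,3)]
  by eventually_elim
     (auto intro!: tendsto_upperbound[OF assms(2)] elim: eventually_mono)

lemma iter_small_limit:
  assumes "iter_small E" "\<And>m. E m \<longlonglongrightarrow> g m" "g \<longlonglongrightarrow> L"
  shows "L \<le> 0"
proof (rule field_le_epsilon)
  fix e :: real
  assume "0 < e"
  then show "L \<le> 0 + e"
    using tendsto_upperbound[OF assms(3) iter_small_inner_limit[OF assms(1,2)]] by simp
qed

lemma iterated_limit_iter_small:
  assumes "iterated_limit f L"
  shows "iter_small (\<lambda>m n. L - f m n)"
  unfolding iter_small_def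
proof (intro allI impI)
  fix e :: real
  assume "0 < e"
  obtain g where g: "\<And>m. f m \<longlonglongrightarrow> g m" "g \<longlonglongrightarrow> L"
    using assms by (auto simp: iterated_limit_def)
  have "\<forall>\<^sub>F m in sequentially. L - e < g m"
    using g(2) \<open>0 < e\<close> by (intro order_tendstoD(1)) auto
  then show "\<forall>\<^sub>F m in sequentially. \<forall>\<^sub>F n in sequentially. L - f m n < e"
  proof eventually_elim
    case (elim m)
    from order_tendstoD(1)[OF g(1) elim] show ?case
      by eventually_elim simp
  qed
qed

section \<open>Transfer of additivity to the original norm\<close>

text \<open>\<open>K\<close> times the combination with weights \<open>a\<close>, \<open>s\<close>
  is the one with weights \<alpha>, \<beta> plus a combination with nonnegative coefficients; the
  triangle inequality does the rest. This replaces the weights \<open>norm (x m)\<close>,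
  \<open>norm (y n)\<close> by prescribed ones.\<close>

lemma norm_defect_weights:
  fixes u v :: "'a::real_normed_vector"
  assumes "\<alpha> \<le> K * a" "\<beta> \<le> K * s" "0 \<le> K"
  shows "\<alpha> * norm u + \<beta> * norm v - norm (\<alpha> *\<^sub>R u + \<beta> *\<^sub>R v)
    \<le> K * (a * norm u + s * norm v - norm (a *\<^sub>R u + s *\<^sub>R v))"
proof -
  have "K *\<^sub>R (a *\<^sub>R u + s *\<^sub>R v) = (\<alpha> *\<^sub>R u + \<beta> *\<^sub>R v) + ((K * a - \<alpha>) *\<^sub>R u + (K * s - \<beta>) *\<^sub>R v)"
    by (simp add: algebra_simps)
  then have "norm (K *\<^sub>R (a *\<^sub>R u + s *\<^sub>R v))
      \<le> norm (\<alpha> *\<^sub>R u + \<beta> *\<^sub>R v) + (norm ((K * a - \<alpha>) *\<^sub>R u) + norm ((K * s - \<beta>) *\<^sub>R v))"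
    by (metis add_left_mono norm_triangle_ineq order_trans)
  with assms have "K * norm (a *\<^sub>R u + s *\<^sub>R v)
      \<le> norm (\<alpha> *\<^sub>R u + \<beta> *\<^sub>R v) + ((K * a - \<alpha>) * norm u + (K * s - \<beta>) * norm v)"
    by simp
  then show ?thesis by (simp add: algebra_simps)
qed

text \<open>The difference is nonnegative by the triangle inequality, so one-sided smallness is
  enough to express that it vanishes asymptotically.\<close>

definition asymp_additive :: "(nat \<Rightarrow> 'a::real_normed_vector) \<Rightarrow> (nat \<Rightarrow> 'a) \<Rightarrow> bool" where
  "asymp_additive x y \<longleftrightarrow> (\<forall>c \<alpha> \<beta>. 0 \<le> \<alpha> \<longrightarrow> 0 \<le> \<beta> \<longrightarrow>
    iter_small (\<lambda>m n. \<alpha> * norm (c + x m) + \<beta> * norm (c + y n)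
      - norm ((\<alpha> + \<beta>) *\<^sub>R c + \<alpha> *\<^sub>R x m + \<beta> *\<^sub>R y n)))"

text \<open>At a centre \<open>c k\<close> the defect is at most a constant times the defect of
  \<open>os_sum\<close>, which is iteratively small by \<open>lim\<close>. Any other centre is first
  moved to a nearby \<open>c k\<close>.\<close>

lemma asymp_additive_os_sum:
  fixes c :: "nat \<Rightarrow> 'a::real_normed_vector"
  assumes dense: "\<And>x e. 0 < e \<Longrightarrow> \<exists>k. norm (x - c k) < e"
    and x: "\<And>m. os_sum c (x m) = 1" and y: "\<And>n. os_sum c (y n) = 1"
    and lim: "iterated_limit (\<lambda>m n. os_sum c (x m + y n)) 2"
  shows "asymp_additive (\<lambda>m. sgn (x m)) (\<lambda>n. sgn (y n))"
  unfolding asymp_additive_def iter_small_def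
proof (intro allI impI)
  fix d :: 'a and \<alpha> \<beta> e :: real
  assume \<alpha>: "0 \<le> \<alpha>" and \<beta>: "0 \<le> \<beta>" and e: "0 < e"
  define E where "E d m n = \<alpha> * norm (d + sgn (x m)) + \<beta> * norm (d + sgn (y n))
      - norm ((\<alpha> + \<beta>) *\<^sub>R d + \<alpha> *\<^sub>R sgn (x m) + \<beta> *\<^sub>R sgn (y n))" for d m n
  \<comment> \<open>Moving the centre changes the defect by at most
    \<open>2 * (\<alpha> + \<beta>) * norm (d - c k)\<close>, which this choice keeps within
    \<open>e / 2\<close>.\<close>
  obtain k where k: "norm (d - c k) < e / (4 * (\<alpha> + \<beta> + 1))"
    using dense[of "e / (4 * (\<alpha> + \<beta> + 1))" d] e \<alpha> \<beta> by auto
  have k': "2 * (\<alpha> + \<beta>) * norm (d - c k) \<le> e / 2"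
  proof -
    have "2 * (\<alpha> + \<beta>) * norm (d - c k) \<le> 2 * (\<alpha> + \<beta> + 1) * (e / (4 * (\<alpha> + \<beta> + 1)))"
      using k \<alpha> \<beta> by (intro mult_mono) auto
    also have "\<dots> = e / 2"
      using \<alpha> \<beta> by (simp add: field_simps add_nonneg_eq_0_iff)
    finally show ?thesis .
  qed
  have E_shift: "E d m n \<le> E (c k) m n + 2 * (\<alpha> + \<beta>) * norm (d - c k)" for m n
  proof -
    have "norm (d + z) \<le> norm (c k + z) + norm (d - c k)" for z
      using norm_triangle_ineq[of "c k + z" "d - c k"] by (simp add: algebra_simps)
    from mult_left_mono[OF this \<alpha>] mult_left_mono[OF this \<beta>]
    have 1: "\<alpha> * norm (d + sgn (x m)) \<le> \<alpha> * norm (c k + sgn (x m)) + \<alpha> * norm (d - c k)"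
      "\<beta> * norm (d + sgn (y n)) \<le> \<beta> * norm (c k + sgn (y n)) + \<beta> * norm (d - c k)"
      by (simp_all add: distrib_left)
    have "norm ((\<alpha> + \<beta>) *\<^sub>R c k + \<alpha> *\<^sub>R sgn (x m) + \<beta> *\<^sub>R sgn (y n))
      \<le> norm ((\<alpha> + \<beta>) *\<^sub>R d + \<alpha> *\<^sub>R sgn (x m) + \<beta> *\<^sub>R sgn (y n)) + norm ((\<alpha> + \<beta>) *\<^sub>R (d - c k))"
      using norm_triangle_ineq4[of "(\<alpha> + \<beta>) *\<^sub>R d + \<alpha> *\<^sub>R sgn (x m) + \<beta> *\<^sub>R sgn (y n)" "(\<alpha> + \<beta>) *\<^sub>R (d - c k)"]
      by (simp add: algebra_simps)
    moreover have "norm ((\<alpha> + \<beta>) *\<^sub>R (d - c k)) = (\<alpha> + \<beta>) * norm (d - c k)"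
      using \<alpha> \<beta> by simp
    ultimately show ?thesis
      using 1 unfolding E_def by (simp add: algebra_simps)
  qed
  \<comment> \<open>By \<open>os_sum_le\<close>, vectors with \<open>os_sum\<close> equal to 1 have
    original norm at least 1/4; hence \<open>K * norm (x m)\<close> dominates \<alpha> and
    \<open>K * norm (y n)\<close> dominates \<beta>. The summand 1 makes \<open>K\<close>
    positive.\<close>
  define K where "K = 4 * (\<alpha> + \<beta>) + 1"
  define p where "p = (1/2)^k / (1 + norm (c k))"
  have K: "0 < K" and p: "0 < p"
    using \<alpha> \<beta> one_plus_norm_pos[of "c k"] by (auto simp: K_def p_def)
  have E_le: "E (c k) m n \<le> K / p * (2 - os_sum c (x m + y n))" for m n
  proof -
    have nz: "1 \<le> 4 * norm (x m)" "1 \<le> 4 * norm (y n)"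
      using os_sum_le[of c "x m"] os_sum_le[of c "y n"] x y by simp_all
    have polar: "norm z *\<^sub>R c k + z = norm z *\<^sub>R (c k + sgn z)" for z
      by (cases "z = 0") (simp_all add: sgn_div_norm scaleR_add_right)
    have \<alpha>K: "\<alpha> \<le> K * norm (x m)" and \<beta>K: "\<beta> \<le> K * norm (y n)"
    proof -
      have "\<alpha> * 1 \<le> \<alpha> * (4 * norm (x m))" "\<beta> * 1 \<le> \<beta> * (4 * norm (y n))"
        by (rule mult_left_mono[OF nz(1) \<alpha>], rule mult_left_mono[OF nz(2) \<beta>])
      moreover have "0 \<le> (4 * \<beta> + 1) * norm (x m)" "0 \<le> (4 * \<alpha> + 1) * norm (y n)"
        using \<alpha> \<beta> by simp_all
      ultimately show "\<alpha> \<le> K * norm (x m)" "\<beta> \<le> K * norm (y n)"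
        by (simp_all add: K_def algebra_simps)
    qed
    have "E (c k) m n = \<alpha> * norm (c k + sgn (x m)) + \<beta> * norm (c k + sgn (y n))
        - norm (\<alpha> *\<^sub>R (c k + sgn (x m)) + \<beta> *\<^sub>R (c k + sgn (y n)))"
      by (simp add: E_def algebra_simps)
    also have "\<dots> \<le> K * (norm (x m) * norm (c k + sgn (x m)) + norm (y n) * norm (c k + sgn (y n))
        - norm (norm (x m) *\<^sub>R (c k + sgn (x m)) + norm (y n) *\<^sub>R (c k + sgn (y n))))"
      using K by (intro norm_defect_weights \<alpha>K \<beta>K) simp
    also have "\<dots> = K * (norm (norm (x m) *\<^sub>R c k + x m) + norm (norm (y n) *\<^sub>R c k + y n)
        - norm ((norm (x m) + norm (y n)) *\<^sub>R c k + x m + y n))"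
    proof -
      have "(norm (x m) + norm (y n)) *\<^sub>R c k + x m + y n
          = (norm (x m) *\<^sub>R c k + x m) + (norm (y n) *\<^sub>R c k + y n)"
        by (simp add: algebra_simps)
      then show ?thesis by (simp only: polar norm_scaleR abs_norm_cancel)
    qed
    also have "\<dots> \<le> K * (os_norm (c k) (x m) + os_norm (c k) (y n) - os_norm (c k) (x m + y n))"
      using K by (intro mult_left_mono os_norm_defect) simp
    also have "\<dots> = K / p * (p * (os_norm (c k) (x m) + os_norm (c k) (y n) - os_norm (c k) (x m + y n)))"
      using p by simp
    also have "\<dots> \<le> K / p * (os_sum c (x m) + os_sum c (y n) - os_sum c (x m + y n))"
      unfolding p_def using K p by (intro mult_left_mono os_sum_defect) (simp add: p_def)
    finally show ?thesis by (simp add: x y)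
  qed
  have "0 < e / 2 * (p / K)"
    using e p K by simp
  from iter_smallD[OF iterated_limit_iter_small[OF lim] this]
  have "\<forall>\<^sub>F m in sequentially. \<forall>\<^sub>F n in sequentially. E d m n < e"
  proof (rule eventually_mono, elim eventually_mono)
    fix m n
    assume "2 - os_sum c (x m + y n) < e / 2 * (p / K)"
    then have "K / p * (2 - os_sum c (x m + y n)) < K / p * (e / 2 * (p / K))"
      using K p by (intro mult_strict_left_mono) auto
    also have "\<dots> = e / 2"
      using K p by simp
    finally show "E d m n < e"
      using E_le[of m n] E_shift[of m n] k' by linarith
  qed
  then show "\<forall>\<^sub>F m in sequentially. \<forall>\<^sub>F n in sequentially.
      \<alpha> * norm (d + sgn (x m)) + \<beta> * norm (d + sgn (y n))
      - norm ((\<alpha> + \<beta>) *\<^sub>R d + \<alpha> *\<^sub>R sgn (x m) + \<beta> *\<^sub>R sgn (y n)) < e"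
    by (simp add: E_def)
qed

lemma asymp_additive_subseq:
  assumes "asymp_additive x y" "strict_mono r" "strict_mono q"
  shows "asymp_additive (\<lambda>m. x (r m)) (\<lambda>n. y (q n))"
  unfolding asymp_additive_def
proof (intro allI impI)
  fix c \<alpha> \<beta>
  assume "0 \<le> (\<alpha>::real)" "0 \<le> (\<beta>::real)"
  with assms(1) have "iter_small (\<lambda>m n. \<alpha> * norm (c + x m) + \<beta> * norm (c + y n)
      - norm ((\<alpha> + \<beta>) *\<^sub>R c + \<alpha> *\<^sub>R x m + \<beta> *\<^sub>R y n))"
    by (simp add: asymp_additive_def)
  from iter_small_subseq[OF this assms(2,3)]
  show "iter_small (\<lambda>m n. \<alpha> * norm (c + x (r m)) + \<beta> * norm (c + y (q n))
      - norm ((\<alpha> + \<beta>) *\<^sub>R c + \<alpha> *\<^sub>R x (r m) + \<beta> *\<^sub>R y (q n)))" .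
qed

section \<open>Limits of translated norms along subsequences\<close>

text \<open>A diagonal argument handles the countably many centres \<open>c k\<close>; since the
  norm is 1-Lipschitz, density extends the convergence to every centre.\<close>

lemma convergent_norms_subseq:
  fixes c x :: "nat \<Rightarrow> 'a::real_normed_vector"
  assumes dense: "\<And>x e. 0 < e \<Longrightarrow> \<exists>k. norm (x - c k) < e"
    and x: "\<And>n. norm (x n) \<le> B"
  obtains r where "strict_mono r" "\<And>d. convergent (\<lambda>n. norm (d + x (r n)))"
proof -
  interpret subseqs "\<lambda>k r. convergent (\<lambda>n. norm (c k + x (r n)))"
  proof
    fix k and s :: "nat \<Rightarrow> nat"
    have "norm (c k + x (s n)) \<in> {0..norm (c k) + B}" for n
      using norm_triangle_ineq[of "c k" "x (s n)"] x[of "s n"] by auto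
    then obtain l r where "strict_mono r" "((\<lambda>n. norm (c k + x (s n))) \<circ> r) \<longlonglongrightarrow> l"
      using compact_imp_seq_compact[OF compact_Icc[of 0 "norm (c k) + B"]] unfolding seq_compact_def
      by metis
    then show "\<exists>r'. strict_mono r' \<and> convergent (\<lambda>n. norm (c k + x ((s \<circ> r') n)))"
      by (auto simp: convergent_def o_def)
  qed
  have conv: "convergent (\<lambda>n. norm (c k + x (diagseq n)))" for k
  proof -
    \<comment> \<open>The diagonal sequence refines the subsequence chosen for \<open>k\<close> only
      from a later index on, hence the shift by \<open>Suc k\<close>.\<close>
    have "convergent (\<lambda>n. norm (c k + x ((diagseq \<circ> (+) (Suc k)) n)))"
    proof (rule diagseq_holds)
      fix r s :: "nat \<Rightarrow> nat" and n
      assume "strict_mono r" "convergent (\<lambda>i. norm (c n + x (s i)))"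
      from convergent_subseq_convergent[OF this(2,1)]
      show "convergent (\<lambda>i. norm (c n + x ((s \<circ> r) i)))"
        by (simp add: o_def)
    qed
    then show ?thesis
      using convergent_ignore_initial_segment[of "\<lambda>n. norm (c k + x (diagseq n))" "Suc k"]
      by (simp add: o_def add.commute)
  qed
  have "convergent (\<lambda>n. norm (d + x (diagseq n)))" for d
  proof (rule Cauchy_convergent, rule metric_CauchyI)
    fix e :: real
    assume "0 < e"
    with dense[of "e / 3" d] obtain k where k: "norm (d - c k) < e / 3"
      by auto
    obtain M where M: "\<And>m n. m \<ge> M \<Longrightarrow> n \<ge> M \<Longrightarrow>
        dist (norm (c k + x (diagseq m))) (norm (c k + x (diagseq n))) < e / 3"
      using metric_CauchyD[OF convergent_Cauchy[OF conv[of k]], of "e / 3"] \<open>0 < e\<close> by auto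
    have near: "\<bar>norm (d + z) - norm (c k + z)\<bar> < e / 3" for z
      using norm_triangle_ineq3[of "d + z" "c k + z"] k by simp
    show "\<exists>M. \<forall>m\<ge>M. \<forall>n\<ge>M. dist (norm (d + x (diagseq m))) (norm (d + x (diagseq n))) < e"
    proof (intro exI[of _ M] allI impI)
      fix m n
      assume "M \<le> m" "M \<le> n"
      from M[OF this] near[of "x (diagseq m)"] near[of "x (diagseq n)"]
      show "dist (norm (d + x (diagseq m))) (norm (d + x (diagseq n))) < e"
        unfolding dist_real_def by arith
    qed
  qed
  with subseq_diagseq that show thesis by blast
qed

text \<open>Telescoping along \<open>0, c/n, 2c/n, \<dots>\<close> compares the increments of \<open>f\<close> and \<open>g\<close>.\<close>

lemma exchange_inequality_imp_le:
  fixes f g :: "'a::real_normed_vector \<Rightarrow> real"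
  assumes exch: "\<And>c d. f c + g c \<le> f (c + d) + g (c - d)"
    and lip: "\<And>c d. \<bar>g c - g d\<bar> \<le> norm (c - d)"
    and zero: "f 0 = g 0"
  shows "g c \<le> f c"
proof (rule field_le_epsilon)
  fix e :: real
  assume "0 < e"
  obtain n where n: "2 * norm c / e < real n"
    using reals_Archimedean2 by blast
  moreover have "0 \<le> 2 * norm c / e"
    using \<open>0 < e\<close> by simp
  ultimately have n0: "0 < real n" by linarith
  define d where "d = c /\<^sub>R real n"
  have nd: "real n *\<^sub>R d = c" and d: "2 * norm d \<le> e"
    using n n0 \<open>0 < e\<close> by (auto simp: d_def field_simps)
  \<comment> \<open>The exchange at \<open>k *\<^sub>R d\<close> pairs \<open>f\<close> one step
    ahead with \<open>g\<close> one step behind. The resulting lag costs \<open>norm d\<close> at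
    each end, which is why \<open>n\<close> was chosen with
    \<open>2 * norm d \<le> e\<close>.\<close>
  have tele: "g ((real k - 1) *\<^sub>R d) - g (- d) \<le> f (real k *\<^sub>R d) - f 0" for k
  proof (induction k)
    case (Suc k)
    have "f (real k *\<^sub>R d) + g (real k *\<^sub>R d) \<le> f (real (Suc k) *\<^sub>R d) + g ((real k - 1) *\<^sub>R d)"
      using exch[of "real k *\<^sub>R d" d] by (simp add: algebra_simps)
    with Suc show ?case by simp
  qed simp
  have "(real n - 1) *\<^sub>R d - c = - d"
    by (simp add: nd algebra_simps)
  with lip[of "(real n - 1) *\<^sub>R d" c] lip[of "- d" 0]
  have "\<bar>g ((real n - 1) *\<^sub>R d) - g c\<bar> \<le> norm d" "\<bar>g (- d) - g 0\<bar> \<le> norm d"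
    by simp_all
  with tele[of n] d zero nd show "g c \<le> f c + e"
    by simp
qed

lemma norm_limit_lipschitz:
  fixes x :: "nat \<Rightarrow> 'a::real_normed_vector"
  assumes "\<And>c. (\<lambda>n. norm (c + x n)) \<longlonglongrightarrow> \<sigma> c"
  shows "\<bar>\<sigma> c - \<sigma> d\<bar> \<le> norm (c - d)"
proof (rule LIMSEQ_le_const2)
  show "(\<lambda>n. \<bar>norm (c + x n) - norm (d + x n)\<bar>) \<longlonglongrightarrow> \<bar>\<sigma> c - \<sigma> d\<bar>"
    by (intro tendsto_intros assms)
  have "\<bar>norm (c + x n) - norm (d + x n)\<bar> \<le> norm (c - d)" for n
    using norm_triangle_ineq3[of "c + x n" "d + x n"] by simp
  then show "\<exists>N. \<forall>n\<ge>N. \<bar>norm (c + x n) - norm (d + x n)\<bar> \<le> norm (c - d)"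
    by blast
qed

lemma asymp_additive_limits_eq:
  assumes add: "asymp_additive x y"
    and \<sigma>: "\<And>c. (\<lambda>n. norm (c + x n)) \<longlonglongrightarrow> \<sigma> c"
    and \<tau>: "\<And>c. (\<lambda>n. norm (c + y n)) \<longlonglongrightarrow> \<tau> c"
    and zero: "\<sigma> 0 = \<tau> 0"
  shows "\<sigma> c = \<tau> c"
proof -
  have exch: "\<sigma> c + \<tau> c \<le> \<sigma> (c + d) + \<tau> (c - d)" for c d
  proof -
    have "iter_small (\<lambda>m n. 1 * norm (c + x m) + 1 * norm (c + y n)
        - norm ((1 + 1) *\<^sub>R c + 1 *\<^sub>R x m + 1 *\<^sub>R y n))"
      using add zero_le_one unfolding asymp_additive_def by blast
    then have "iter_small (\<lambda>m n. norm (c + x m) + norm (c + y n) - norm ((c + d) + x m) - norm ((c - d) + y n))"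
    proof (rule iter_small_dominated)
      fix m n
      \<comment> \<open>The vector \<open>2c + x m + y n\<close> is regrouped with the centre moved
        by \<open>d\<close> in opposite directions.\<close>
      have "norm ((1 + 1) *\<^sub>R c + 1 *\<^sub>R x m + 1 *\<^sub>R y n) \<le> norm ((c + d) + x m) + norm ((c - d) + y n)"
        using norm_triangle_ineq[of "(c + d) + x m" "(c - d) + y n"]
        by (simp add: algebra_simps scaleR_2)
      then show "norm (c + x m) + norm (c + y n) - norm ((c + d) + x m) - norm ((c - d) + y n)
        \<le> 1 * norm (c + x m) + 1 * norm (c + y n) - norm ((1 + 1) *\<^sub>R c + 1 *\<^sub>R x m + 1 *\<^sub>R y n)"
        by simp
    qed
    then have "\<sigma> c + \<tau> c - \<sigma> (c + d) - \<tau> (c - d) \<le> 0"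
    proof (rule iter_small_limit)
      show "(\<lambda>n. norm (c + x m) + norm (c + y n) - norm ((c + d) + x m) - norm ((c - d) + y n))
          \<longlonglongrightarrow> norm (c + x m) + \<tau> c - norm ((c + d) + x m) - \<tau> (c - d)" for m
        by (intro tendsto_diff tendsto_add tendsto_const \<tau>)
      show "(\<lambda>m. norm (c + x m) + \<tau> c - norm ((c + d) + x m) - \<tau> (c - d))
          \<longlonglongrightarrow> \<sigma> c + \<tau> c - \<sigma> (c + d) - \<tau> (c - d)"
        by (intro tendsto_diff tendsto_add tendsto_const \<sigma>)
    qed
    then show ?thesis by simp
  qed
  \<comment> \<open>Replacing \<open>d\<close> by \<open>- d\<close> swaps the two functions, so the
    exchange argument yields both inequalities.\<close>
  have "\<tau> c + \<sigma> c \<le> \<tau> (c + d) + \<sigma> (c - d)" for c d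
    using exch[of c "- d"] by simp
  then show ?thesis
    using exchange_inequality_imp_le[of \<sigma> \<tau> c, OF exch norm_limit_lipschitz[OF \<tau>] zero]
      exchange_inequality_imp_le[of \<tau> \<sigma> c, OF _ norm_limit_lipschitz[OF \<sigma>] zero[symmetric]]
    by (simp add: order_antisym)
qed

section \<open>Symmetric types and their uniform lower estimate\<close>

text \<open>This collects what the construction uses after the inner limit has been taken: the
  second sequence has disappeared into \<open>T\<close>, and \<open>T_ge\<close> is what remains of
  asymptotic additivity.\<close>

locale symmetric_type =
  fixes x :: "nat \<Rightarrow> 'a::real_normed_vector" and T :: "real \<Rightarrow> 'a \<Rightarrow> real"
  assumes T_lim: "0 \<le> s \<Longrightarrow> (\<lambda>n. norm (c + s *\<^sub>R x n)) \<longlonglongrightarrow> T s c"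
    and T_minus: "0 \<le> s \<Longrightarrow> T s (- c) = T s c"
    and T_ge: "0 \<le> \<alpha> \<Longrightarrow> 0 \<le> \<beta> \<Longrightarrow> 0 < e \<Longrightarrow>
      \<forall>\<^sub>F m in sequentially. T (\<alpha> + \<beta>) c - e \<le> T \<beta> (c + \<alpha> *\<^sub>R x m)"
    and norm_x: "norm (x n) = 1"
begin

lemma T_zero_left: "T 0 c = norm c"
  using LIMSEQ_unique[OF T_lim[of 0 c]] by simp

lemma T_zero_right: "0 \<le> s \<Longrightarrow> T s 0 = s"
  using LIMSEQ_unique[OF T_lim[of s 0], of s] by (simp add: norm_x)

lemma T_scaleR:
  assumes "0 \<le> l" "0 \<le> s"
  shows "T (l * s) (l *\<^sub>R c) = l * T s c"
proof (rule LIMSEQ_unique[OF T_lim])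
  have "norm (l *\<^sub>R c + (l * s) *\<^sub>R x n) = l * norm (c + s *\<^sub>R x n)" for n
    using assms norm_scaleR[of l "c + s *\<^sub>R x n"] by (simp add: scaleR_add_right)
  then show "(\<lambda>n. norm (l *\<^sub>R c + (l * s) *\<^sub>R x n)) \<longlonglongrightarrow> l * T s c"
    using tendsto_mult_left[OF T_lim[OF assms(2)]] by simp
qed (use assms in simp)

lemma T_lipschitz:
  assumes "0 \<le> s" "0 \<le> t"
  shows "T s c \<le> T t d + norm (c - d) + \<bar>s - t\<bar>"
proof (rule LIMSEQ_le)
  show "(\<lambda>n. norm (c + s *\<^sub>R x n)) \<longlonglongrightarrow> T s c"
    by (rule T_lim[OF assms(1)])
  show "(\<lambda>n. norm (d + t *\<^sub>R x n) + norm (c - d) + \<bar>s - t\<bar>) \<longlonglongrightarrow> T t d + norm (c - d) + \<bar>s - t\<bar>"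
    by (intro tendsto_intros T_lim assms(2))
  have "norm (c + s *\<^sub>R x n) \<le> norm (d + t *\<^sub>R x n) + norm (c - d) + \<bar>s - t\<bar>" for n
  proof -
    have "c + s *\<^sub>R x n = (d + t *\<^sub>R x n) + (c - d) + (s - t) *\<^sub>R x n"
      by (simp add: algebra_simps)
    then have "norm (c + s *\<^sub>R x n) \<le> norm (d + t *\<^sub>R x n) + norm (c - d) + norm ((s - t) *\<^sub>R x n)"
      by (metis norm_triangle_le norm_triangle_ineq add_right_mono)
    then show ?thesis by (simp add: norm_x)
  qed
  then show "\<exists>N. \<forall>n\<ge>N. norm (c + s *\<^sub>R x n) \<le> norm (d + t *\<^sub>R x n) + norm (c - d) + \<bar>s - t\<bar>"
    by blast
qed

text \<open>A negative coefficient is handled by reflecting both the centre and the coefficient,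
  using that \<open>T s\<close> is even.\<close>

lemma T_ge_abs:
  assumes "0 \<le> s" "0 < e"
  shows "\<forall>\<^sub>F m in sequentially. T (\<bar>\<alpha>\<bar> + s) c - e \<le> T s (c + \<alpha> *\<^sub>R x m)"
proof (cases "0 \<le> \<alpha>")
  case True
  then show ?thesis using T_ge[of \<alpha> s e c] assms by simp
next
  case False
  have "T s (- c + (- \<alpha>) *\<^sub>R x m) = T s (c + \<alpha> *\<^sub>R x m)" for m
    using T_minus[OF assms(1), of "c + \<alpha> *\<^sub>R x m"] by simp
  moreover have "T (- \<alpha> + s) (- c) = T (- \<alpha> + s) c"
    using False assms by (intro T_minus) simp
  ultimately show ?thesis
    using T_ge[of "- \<alpha>" s e "- c"] False assms by simp
qed

text \<open>Both sides are Lipschitz in all three parameters, with constants independent of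
  \<open>m\<close>, so it suffices to treat a finite net of the compact parameter set.\<close>

lemma T_ge_uniform:
  assumes K: "compact K" and e: "0 < e"
  shows "\<forall>\<^sub>F m in sequentially. \<forall>c\<in>K. \<forall>\<alpha>\<in>{-1..1}. \<forall>s\<in>{0..1}.
    T (\<bar>\<alpha>\<bar> + s) c - e \<le> T s (c + \<alpha> *\<^sub>R x m)"
proof -
  let ?Q = "K \<times> {-1..1::real} \<times> {0..1::real}"
  have "compact ?Q"
    by (intro compact_Times K compact_Icc)
  \<comment> \<open>Leaving a net point costs three distances below \<open>e/8\<close> on either
    side; with the error \<open>e/4\<close> at the net point this adds up to
    \<open>e\<close>.\<close>
  then obtain F where F: "finite F" "F \<subseteq> ?Q" "?Q \<subseteq> (\<Union>q\<in>F. ball q (e/8))"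
    using seq_compact_imp_totally_bounded[OF compact_imp_seq_compact, of ?Q] e
    by (meson divide_pos_pos zero_less_numeral)
  have "\<forall>\<^sub>F m in sequentially. \<forall>q\<in>F. case q of (c, \<alpha>, s) \<Rightarrow>
      T (\<bar>\<alpha>\<bar> + s) c - e/4 \<le> T s (c + \<alpha> *\<^sub>R x m)"
    using F(1,2) e by (intro eventually_ball_finite) (auto intro!: T_ge_abs)
  then show ?thesis
  proof (rule eventually_mono, intro ballI)
    fix m c and \<alpha> s :: real
    assume net: "\<forall>q\<in>F. case q of (c, \<alpha>, s) \<Rightarrow> T (\<bar>\<alpha>\<bar> + s) c - e/4 \<le> T s (c + \<alpha> *\<^sub>R x m)"
      and c: "c \<in> K" and \<alpha>: "\<alpha> \<in> {-1..1}" and s: "s \<in> {0..1}"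
    have "(c, \<alpha>, s) \<in> ?Q" using c \<alpha> s by simp
    with F(3) obtain q where q: "q \<in> F" "dist q (c, \<alpha>, s) < e/8"
      by fastforce
    obtain c' \<alpha>' s' where q_eq: "q = (c', \<alpha>', s')"
      by (cases q)
    have s': "0 \<le> s'" using F(2) q(1) q_eq by auto
    have "dist c' c < e/8" "dist (\<alpha>', s') (\<alpha>, s) < e/8"
      using q(2) dist_fst_le[of q "(c, \<alpha>, s)"] dist_snd_le[of q "(c, \<alpha>, s)"] by (auto simp: q_eq)
    moreover from this(2) have "dist \<alpha>' \<alpha> < e/8" "dist s' s < e/8"
      using dist_fst_le[of "(\<alpha>', s')" "(\<alpha>, s)"] dist_snd_le[of "(\<alpha>', s')" "(\<alpha>, s)"] by auto
    ultimately have near: "norm (c - c') < e/8" "\<bar>\<alpha> - \<alpha>'\<bar> < e/8" "\<bar>s - s'\<bar> < e/8"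
      by (auto simp: dist_norm norm_minus_commute abs_minus_commute)
    have "T (\<bar>\<alpha>\<bar> + s) c \<le> T (\<bar>\<alpha>'\<bar> + s') c' + norm (c - c') + \<bar>(\<bar>\<alpha>\<bar> + s) - (\<bar>\<alpha>'\<bar> + s')\<bar>"
      using s s' by (intro T_lipschitz) auto
    moreover have "T (\<bar>\<alpha>'\<bar> + s') c' - e/4 \<le> T s' (c' + \<alpha>' *\<^sub>R x m)"
      using net q(1) q_eq by auto
    moreover have "T s' (c' + \<alpha>' *\<^sub>R x m)
        \<le> T s (c + \<alpha> *\<^sub>R x m) + norm ((c' + \<alpha>' *\<^sub>R x m) - (c + \<alpha> *\<^sub>R x m)) + \<bar>s' - s\<bar>"
      using s s' by (intro T_lipschitz) auto
    moreover have "norm ((c' + \<alpha>' *\<^sub>R x m) - (c + \<alpha> *\<^sub>R x m)) \<le> norm (c - c') + \<bar>\<alpha> - \<alpha>'\<bar>"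
    proof -
      have "(c' + \<alpha>' *\<^sub>R x m) - (c + \<alpha> *\<^sub>R x m) = - (c - c') - (\<alpha> - \<alpha>') *\<^sub>R x m"
        by (simp add: algebra_simps)
      then show ?thesis
        using norm_triangle_ineq4[of "- (c - c')" "(\<alpha> - \<alpha>') *\<^sub>R x m"]
        by (simp only: norm_scaleR norm_x norm_minus_cancel mult_1_right)
    qed
    ultimately show "T (\<bar>\<alpha>\<bar> + s) c - e \<le> T s (c + \<alpha> *\<^sub>R x m)"
      using near by linarith
  qed
qed

end

section \<open>Inductive choice of a sequence with a lower estimate\<close>

lemma compact_bounded_combinations:
  fixes z :: "nat \<Rightarrow> 'a::real_normed_vector"
  shows "compact {\<Sum>i<k. a i *\<^sub>R z i |a. \<forall>i<k. \<bar>a i\<bar> \<le> 1}"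
proof (induction k)
  case (Suc k)
  let ?P = "\<lambda>k. {\<Sum>i<k. a i *\<^sub>R z i |a. \<forall>i<k. \<bar>a i\<bar> \<le> (1::real)}"
  have "?P (Suc k) = (\<lambda>(c, t). c + t *\<^sub>R z k) ` (?P k \<times> {-1..1})"
  proof (intro equalityI subsetI)
    fix v
    assume "v \<in> ?P (Suc k)"
    then obtain a where a: "v = (\<Sum>i<Suc k. a i *\<^sub>R z i)" "\<forall>i<Suc k. \<bar>a i\<bar> \<le> 1"
      by blast
    then have "((\<Sum>i<k. a i *\<^sub>R z i), a k) \<in> ?P k \<times> {-1..1}"
      using a(2)[rule_format, of k] by (auto simp: abs_le_iff)
    with a(1) show "v \<in> (\<lambda>(c, t). c + t *\<^sub>R z k) ` (?P k \<times> {-1..1})"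
      by (auto intro!: rev_image_eqI)
  next
    fix v
    assume "v \<in> (\<lambda>(c, t). c + t *\<^sub>R z k) ` (?P k \<times> {-1..1})"
    then obtain a t where a: "v = (\<Sum>i<k. a i *\<^sub>R z i) + t *\<^sub>R z k" "\<forall>i<k. \<bar>a i\<bar> \<le> 1" "t \<in> {-1..1}"
      by auto
    then have "v = (\<Sum>i<Suc k. (a(k := t)) i *\<^sub>R z i)" "\<forall>i<Suc k. \<bar>(a(k := t)) i\<bar> \<le> 1"
      by (auto simp: less_Suc_eq abs_le_iff)
    then show "v \<in> ?P (Suc k)" by blast
  qed
  moreover have "compact ((\<lambda>(c, t). c + t *\<^sub>R z k) ` (?P k \<times> {-1..1}))"
    by (intro compact_continuous_image compact_Times Suc compact_Icc)
       (auto simp: split_beta intro!: continuous_intros)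
  ultimately show ?case by simp
qed simp

context symmetric_type
begin

text \<open>The extra weight \<open>s\<close> is a reserve for a vector still to be chosen, held in
  the limit \<open>T s\<close>; it is what lets the induction proceed. Taking \<open>s = 0\<close>
  recovers an estimate for the norm.\<close>

definition lower_ell1 :: "real \<Rightarrow> nat \<Rightarrow> (nat \<Rightarrow> 'a) \<Rightarrow> bool" where
  "lower_ell1 \<delta> k z \<longleftrightarrow> (\<forall>a s. 0 \<le> s \<longrightarrow> \<delta> * ((\<Sum>i<k. \<bar>a i\<bar>) + s) \<le> T s (\<Sum>i<k. a i *\<^sub>R z i))"

text \<open>Part of the reserve is spent on the new vector: the estimate for \<open>z\<close> with
  reserve \<open>\<bar>a k\<bar> + s\<close> passes, up to \<open>\<delta> - \<epsilon>\<close>, to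
  the extended system with reserve \<open>s\<close>. Compactness gives one \<open>m\<close> for all
  coefficients of total weight 1, and homogeneity covers the others.\<close>

lemma lower_ell1_extend:
  assumes z: "lower_ell1 \<delta> k z" and "\<epsilon> < \<delta>"
  shows "\<exists>m. lower_ell1 \<epsilon> (Suc k) (z(k := x m))"
proof -
  let ?P = "{\<Sum>i<k. a i *\<^sub>R z i |a. \<forall>i<k. \<bar>a i\<bar> \<le> 1}"
  have "\<forall>\<^sub>F m in sequentially. \<forall>c\<in>?P. \<forall>\<alpha>\<in>{-1..1}. \<forall>s\<in>{0..1}.
      T (\<bar>\<alpha>\<bar> + s) c - (\<delta> - \<epsilon>) \<le> T s (c + \<alpha> *\<^sub>R x m)"
    using assms by (intro T_ge_uniform compact_bounded_combinations) simp
  then obtain m where m: "\<And>c \<alpha> s. c \<in> ?P \<Longrightarrow> \<alpha> \<in> {-1..1} \<Longrightarrow> s \<in> {0..1} \<Longrightarrow>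
      T (\<bar>\<alpha>\<bar> + s) c - (\<delta> - \<epsilon>) \<le> T s (c + \<alpha> *\<^sub>R x m)"
    unfolding eventually_sequentially by blast
  have "\<epsilon> * ((\<Sum>i<Suc k. \<bar>a i\<bar>) + s) \<le> T s (\<Sum>i<Suc k. a i *\<^sub>R (z(k := x m)) i)" if s: "0 \<le> s" for a s
  proof -
    define M where "M = (\<Sum>i<Suc k. \<bar>a i\<bar>) + s"
    have upd: "(\<Sum>i<Suc k. b i *\<^sub>R (z(k := x m)) i) = (\<Sum>i<k. b i *\<^sub>R z i) + b k *\<^sub>R x m" for b
      by simp
    have nn: "0 \<le> (\<Sum>i<Suc k. \<bar>a i\<bar>)"
      by (rule sum_nonneg) simp
    show ?thesis
    proof (cases "M = 0")
      case True
      with nn s have "s = 0" "(\<Sum>i<Suc k. \<bar>a i\<bar>) = 0"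
        unfolding M_def by linarith+
      then show ?thesis by (simp add: T_zero_left)
    next
      case False
      with nn s have M: "0 < M" unfolding M_def by linarith
      \<comment> \<open>After normalizing the total weight to 1, the additive loss
        \<open>\<delta> - \<epsilon>\<close> is exactly the loss allowed in the constant.\<close>
      define b where "b i = a i / M" for i
      define t where "t = s / M"
      have a_le: "\<bar>a i\<bar> \<le> M" if "i < Suc k" for i
        using member_le_sum[of i "{..<Suc k}" "\<lambda>i. \<bar>a i\<bar>"] that s by (simp add: M_def)
      have b_le: "\<bar>b i\<bar> \<le> 1" if "i < Suc k" for i
        using a_le[OF that] M by (simp add: b_def)
      have t: "0 \<le> t" "t \<le> 1"
        using s nn M by (auto simp: t_def M_def)
      have total: "(\<Sum>i<k. \<bar>b i\<bar>) + (\<bar>b k\<bar> + t) = 1"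
      proof -
        have "M * ((\<Sum>i<k. \<bar>b i\<bar>) + (\<bar>b k\<bar> + t)) = (\<Sum>i<k. M * \<bar>b i\<bar>) + (M * \<bar>b k\<bar> + M * t)"
          by (simp only: distrib_left sum_distrib_left)
        also have "\<dots> = M"
          using M by (simp add: b_def t_def abs_divide) (simp add: M_def)
        finally show ?thesis using M by simp
      qed
      have "\<delta> \<le> T (\<bar>b k\<bar> + t) (\<Sum>i<k. b i *\<^sub>R z i)"
        using z[unfolded lower_ell1_def, rule_format, of "\<bar>b k\<bar> + t" b] t total by simp
      moreover have "T (\<bar>b k\<bar> + t) (\<Sum>i<k. b i *\<^sub>R z i) - (\<delta> - \<epsilon>) \<le> T t ((\<Sum>i<k. b i *\<^sub>R z i) + b k *\<^sub>R x m)"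
        using b_le t b_le[of k] by (intro m) (auto simp: abs_le_iff)
      ultimately have "\<epsilon> \<le> T t (\<Sum>i<Suc k. b i *\<^sub>R (z(k := x m)) i)"
        unfolding upd by simp
      then have "M * \<epsilon> \<le> M * T t (\<Sum>i<Suc k. b i *\<^sub>R (z(k := x m)) i)"
        using M by simp
      also have "\<dots> = T (M * t) (M *\<^sub>R (\<Sum>i<Suc k. b i *\<^sub>R (z(k := x m)) i))"
        using M t by (intro T_scaleR[symmetric]) auto
      also have "M * t = s"
        using M by (simp add: t_def)
      also have "M *\<^sub>R (\<Sum>i<Suc k. b i *\<^sub>R (z(k := x m)) i) = (\<Sum>i<Suc k. a i *\<^sub>R (z(k := x m)) i)"
        using M unfolding scaleR_sum_right scaleR_scaleR by (simp add: b_def)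
      finally show ?thesis by (simp add: M_def mult.commute)
    qed
  qed
  then show ?thesis unfolding lower_ell1_def by blast
qed

lemma ell1_sequence:
  obtains w :: "nat \<Rightarrow> 'a" where "\<And>i. norm (w i) = 1"
    "\<And>k a. 1/2 * (\<Sum>i<k. \<bar>a i\<bar>) \<le> norm (\<Sum>i<k. a i *\<^sub>R w i)"
proof -
  \<comment> \<open>These constants start at 1, where the empty system satisfies the estimate
    because \<open>T s 0 = s\<close>, and decrease strictly while staying above 1/2, so every
    extension has room for a loss.\<close>
  define \<delta> where "\<delta> k = 1/2 + (1/2::real)^(Suc k)" for k
  have "\<exists>f. \<forall>k. lower_ell1 (\<delta> k) k (f k) \<and> (\<exists>m. f (Suc k) = (f k)(k := x m))"
  proof (rule dependent_nat_choice)
    show "\<exists>z. lower_ell1 (\<delta> 0) 0 z"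
      by (simp add: lower_ell1_def \<delta>_def T_zero_right)
    show "\<exists>y. lower_ell1 (\<delta> (Suc k)) (Suc k) y \<and> (\<exists>m. y = z(k := x m))"
      if "lower_ell1 (\<delta> k) k z" for z k
      using lower_ell1_extend[OF that, of "\<delta> (Suc k)"] by (auto simp: \<delta>_def)
  qed
  then obtain f where f: "\<And>k. lower_ell1 (\<delta> k) k (f k)" "\<And>k. \<exists>m. f (Suc k) = (f k)(k := x m)"
    by blast
  \<comment> \<open>Passing from \<open>f k\<close> to \<open>f (Suc k)\<close> changes only entry
    \<open>k\<close>, so entry \<open>i\<close> is final from \<open>f (Suc i)\<close> on.\<close>
  define w where "w i = f (Suc i) i" for i
  have fw: "f k i = w i" if "i < k" for i k
    using that
  proof (induction k)
    case (Suc k)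
    obtain m where "f (Suc k) = (f k)(k := x m)" using f(2) by blast
    with Suc show ?case by (cases "i = k") (auto simp: w_def)
  qed simp
  show thesis
  proof (rule that)
    show "norm (w i) = 1" for i
      using f(2)[of i] by (auto simp: w_def norm_x)
    show "1/2 * (\<Sum>i<k. \<bar>a i\<bar>) \<le> norm (\<Sum>i<k. a i *\<^sub>R w i)" for k a
    proof -
      have "1/2 * (\<Sum>i<k. \<bar>a i\<bar>) \<le> \<delta> k * (\<Sum>i<k. \<bar>a i\<bar>)"
        by (intro mult_right_mono sum_nonneg) (simp_all add: \<delta>_def)
      also have "\<dots> \<le> T 0 (\<Sum>i<k. a i *\<^sub>R f k i)"
        using f(1)[of k, unfolded lower_ell1_def, rule_format, of 0 a] by simp
      also have "\<dots> = norm (\<Sum>i<k. a i *\<^sub>R w i)"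
        by (simp add: T_zero_left fw)
      finally show ?thesis .
    qed
  qed
qed

end

section \<open>From the sequence to an isomorph of l_1, and conclusion\<close>

text \<open>Completeness turns absolute summability into convergence of the series defining
  \<open>L\<close>; the lower bound passes from partial sums to the limit.\<close>

lemma ell1_sequence_imp_isomorphic:
  fixes w :: "nat \<Rightarrow> 'a::banach"
  assumes w: "\<And>i. norm (w i) = 1"
    and lower: "\<And>k a. 1/2 * (\<Sum>i<k. \<bar>a i\<bar>) \<le> norm (\<Sum>i<k. a i *\<^sub>R w i)"
  shows "\<exists>S::'a set. subspace S \<and> isomorphic_to_ell1 S"
proof -
  define L where "L a = (\<Sum>i. a i *\<^sub>R w i)" for a
  have sumn: "summable (\<lambda>i. norm (a i *\<^sub>R w i))" if "a \<in> ell1" for a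
    using that by (simp add: ell1_def w)
  have summ: "summable (\<lambda>i. a i *\<^sub>R w i)" if "a \<in> ell1" for a
    by (rule summable_norm_cancel[OF sumn[OF that]])
  have ell1_add: "(\<lambda>n. a n + d n) \<in> ell1" if "a \<in> ell1" "d \<in> ell1" for a d
    using that unfolding ell1_def
    by (auto intro!: summable_comparison_test'[OF summable_add, of "\<lambda>n. \<bar>a n\<bar>" "\<lambda>n. \<bar>d n\<bar>" 0])
  have ell1_scale: "(\<lambda>n. r * a n) \<in> ell1" if "a \<in> ell1" for a r
    using that by (simp add: ell1_def abs_mult summable_mult)
  have L_add: "L (\<lambda>n. a n + d n) = L a + L d" if "a \<in> ell1" "d \<in> ell1" for a d
    unfolding L_def scaleR_add_left by (rule suminf_add[symmetric]) (use that summ in auto)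
  have L_scale: "L (\<lambda>n. r * a n) = r *\<^sub>R L a" if "a \<in> ell1" for a r
    using suminf_scaleR_right[OF summ[OF that], of r] by (simp add: L_def)
  have upper: "norm (L a) \<le> 1 * ell1_norm a" if "a \<in> ell1" for a
    using summable_norm[OF sumn[OF that]] by (simp add: L_def ell1_norm_def w)
  have lower': "1/2 * ell1_norm a \<le> norm (L a)" if "a \<in> ell1" for a
  proof (rule LIMSEQ_le)
    show "(\<lambda>k. 1/2 * (\<Sum>i<k. \<bar>a i\<bar>)) \<longlonglongrightarrow> 1/2 * ell1_norm a"
      unfolding ell1_norm_def using that by (intro tendsto_mult_left summable_LIMSEQ) (simp add: ell1_def)
    show "(\<lambda>k. norm (\<Sum>i<k. a i *\<^sub>R w i)) \<longlonglongrightarrow> norm (L a)"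
      unfolding L_def by (intro tendsto_norm summable_LIMSEQ summ that)
  qed (use lower in blast)
  have zero: "(\<lambda>n. 0) \<in> ell1"
    by (simp add: ell1_def)
  have "subspace (L ` ell1)"
    unfolding subspace_def
  proof (intro conjI ballI allI)
    have "L (\<lambda>n. 0) = 0" by (simp add: L_def)
    then show "0 \<in> L ` ell1" using zero by force
  next
    fix u v assume "u \<in> L ` ell1" "v \<in> L ` ell1"
    then show "u + v \<in> L ` ell1"
      using L_add ell1_add by (metis (no_types, lifting) image_iff)
  next
    fix r u assume "u \<in> L ` ell1"
    then show "r *\<^sub>R u \<in> L ` ell1"
      using L_scale ell1_scale by (metis (no_types, lifting) image_iff)
  qed
  moreover have "isomorphic_to_ell1 (L ` ell1)"
    unfolding isomorphic_to_ell1_def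
  proof (intro exI[of _ L] conjI)
    show "\<exists>c>0. \<exists>C>0. \<forall>a\<in>ell1. c * ell1_norm a \<le> norm (L a) \<and> norm (L a) \<le> C * ell1_norm a"
      using lower' upper by (intro exI[of _ "1/2"] exI[of _ 1] conjI) auto
  qed (auto simp: L_add L_scale)
  ultimately show ?thesis by blast
qed

lemma asymp_additive_imp_ell1:
  fixes c x y :: "nat \<Rightarrow> 'a::banach"
  assumes dense: "\<And>x e. 0 < e \<Longrightarrow> \<exists>k. norm (x - c k) < e"
    and x1: "\<And>n. norm (x n) = 1" and y1: "\<And>n. norm (y n) = 1"
    and plus: "asymp_additive x y" and minus: "asymp_additive x (\<lambda>n. - y n)"
  shows "\<exists>S::'a set. subspace S \<and> isomorphic_to_ell1 S"
proof -
  obtain r where r: "strict_mono r" "\<And>d. convergent (\<lambda>n. norm (d + x (r n)))"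
    using convergent_norms_subseq[OF dense, of x 1] x1 by auto
  obtain q where q: "strict_mono q" "\<And>d. convergent (\<lambda>n. norm (d + y (q n)))"
    using convergent_norms_subseq[OF dense, of y 1] y1 by auto
  define X where "X n = x (r n)" for n
  define Y where "Y n = y (q n)" for n
  obtain \<sigma> where \<sigma>: "\<And>d. (\<lambda>n. norm (d + X n)) \<longlonglongrightarrow> \<sigma> d"
    using r(2) unfolding convergent_def X_def by metis
  obtain \<tau> where \<tau>: "\<And>d. (\<lambda>n. norm (d + Y n)) \<longlonglongrightarrow> \<tau> d"
    using q(2) unfolding convergent_def Y_def by metis
  \<comment> \<open>For \<open>- Y\<close> the limit function is \<tau> reflected, so additivity
    with \<open>- Y\<close> will give \<open>\<sigma> d = \<tau> (- d)\<close> and hence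
    evenness.\<close>
  have \<tau>': "(\<lambda>n. norm (d + - Y n)) \<longlonglongrightarrow> \<tau> (- d)" for d
    using \<tau>[of "- d"] norm_minus_cancel[of "d - Y _"] by (simp add: norm_minus_commute)
  have plusXY: "asymp_additive X Y" and minusXY: "asymp_additive X (\<lambda>n. - Y n)"
    using asymp_additive_subseq[OF plus r(1) q(1)] asymp_additive_subseq[OF minus r(1) q(1)]
    by (simp_all add: X_def[abs_def] Y_def[abs_def])
  have zero: "\<sigma> 0 = \<tau> 0"
    using LIMSEQ_unique[OF \<sigma>[of 0], of 1] LIMSEQ_unique[OF \<tau>[of 0], of 1]
    by (simp add: X_def Y_def x1 y1)
  have \<sigma>\<tau>: "\<sigma> d = \<tau> d" for d
    by (rule asymp_additive_limits_eq[OF plusXY \<sigma> \<tau> zero])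
  have "\<sigma> d = \<tau> (- d)" for d
    using asymp_additive_limits_eq[of X _ \<sigma> "\<lambda>d. \<tau> (- d)", OF minusXY \<sigma> \<tau>'] zero by simp
  with \<sigma>\<tau> have even: "\<sigma> (- d) = \<sigma> d" for d
    by (metis minus_minus)
  \<comment> \<open>For \<open>s > 0\<close> homogeneity reduces the limit to \<sigma>;
    \<open>s = 0\<close> is separate because \<open>d /\<^sub>R s\<close> loses \<open>d\<close>
    there.\<close>
  define T where "T s d = (if s = 0 then norm d else s * \<sigma> (d /\<^sub>R s))" for s d
  \<comment> \<open>Stated for any sequence with limit function \<sigma>, since it serves both
    \<open>X\<close> and, by \<open>\<sigma> = \<tau>\<close>, \<open>Y\<close>.\<close>
  have T_limit: "(\<lambda>n. norm (d + s *\<^sub>R Z n)) \<longlonglongrightarrow> T s d"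
    if Z: "\<And>d. (\<lambda>n. norm (d + Z n)) \<longlonglongrightarrow> \<sigma> d" and "0 \<le> s" for Z d s
  proof (cases "s = 0")
    case False
    with \<open>0 \<le> s\<close> have s: "0 < s" by simp
    have "norm (d + s *\<^sub>R Z n) = s * norm (d /\<^sub>R s + Z n)" for n
      using s norm_scaleR[of s "d /\<^sub>R s + Z n"] by (simp add: scaleR_add_right)
    then show ?thesis
      using False tendsto_mult_left[OF Z[of "d /\<^sub>R s"], of s] by (simp add: T_def)
  qed (simp add: T_def)
  interpret symmetric_type X T
  proof
    show "(\<lambda>n. norm (d + s *\<^sub>R X n)) \<longlonglongrightarrow> T s d" if "0 \<le> s" for s d
      by (rule T_limit[OF \<sigma> that])
    show "T s (- d) = T s d" for s d
      by (simp add: T_def even)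
    show "norm (X n) = 1" for n
      by (simp add: X_def x1)
    show "\<forall>\<^sub>F m in sequentially. T (\<alpha> + \<beta>) d - e \<le> T \<beta> (d + \<alpha> *\<^sub>R X m)"
      if \<alpha>: "0 \<le> \<alpha>" and \<beta>: "0 \<le> \<beta>" and e: "0 < e" for \<alpha> \<beta> e d
    proof (cases "\<alpha> + \<beta> = 0")
      case True
      with \<alpha> \<beta> have "\<alpha> = 0" "\<beta> = 0" by simp_all
      with e show ?thesis by simp
    next
      case False
      \<comment> \<open>Additivity is applied at the centre \<open>u\<close>, scaled so that the
        combined centre is \<open>d\<close>. The inner limit over \<open>Y\<close> then produces
        \<open>T \<beta>\<close>, and the outer one over \<open>X\<close> replaces
        \<open>norm (u + X m)\<close> by \<open>\<sigma> u\<close>.\<close>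
      define u where "u = d /\<^sub>R (\<alpha> + \<beta>)"
      have u: "(\<alpha> + \<beta>) *\<^sub>R u = d"
        using False by (simp add: u_def)
      have Tu: "T (\<alpha> + \<beta>) d = \<alpha> * \<sigma> u + \<beta> * \<sigma> u"
        using False by (simp add: u_def T_def distrib_right)
      have small: "iter_small (\<lambda>m n. \<alpha> * norm (u + X m) + \<beta> * norm (u + Y n) - norm (d + \<alpha> *\<^sub>R X m + \<beta> *\<^sub>R Y n))"
        using plusXY[unfolded asymp_additive_def, rule_format, OF \<alpha> \<beta>, of u] unfolding u .
      have Y\<sigma>: "(\<lambda>n. norm (d + Y n)) \<longlonglongrightarrow> \<sigma> d" for d
        using \<tau> by (simp add: \<sigma>\<tau>)
      have "(\<lambda>n. \<alpha> * norm (u + X m) + \<beta> * norm (u + Y n) - norm (d + \<alpha> *\<^sub>R X m + \<beta> *\<^sub>R Y n))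
          \<longlonglongrightarrow> \<alpha> * norm (u + X m) + \<beta> * \<sigma> u - T \<beta> (d + \<alpha> *\<^sub>R X m)" for m
        by (rule tendsto_diff[OF tendsto_add[OF tendsto_const tendsto_mult_left[OF Y\<sigma>]] T_limit[OF Y\<sigma> \<beta>]])
      from iter_small_inner_limit[OF small this half_gt_zero[OF e]]
      have 1: "\<forall>\<^sub>F m in sequentially.
          \<alpha> * norm (u + X m) + \<beta> * \<sigma> u - T \<beta> (d + \<alpha> *\<^sub>R X m) \<le> e / 2" .
      have 2: "\<forall>\<^sub>F m in sequentially. \<alpha> * \<sigma> u - e / 2 < \<alpha> * norm (u + X m)"
        using e by (intro order_tendstoD(1)[OF tendsto_mult_left[OF \<sigma>]]) simp
      from 1 2 show ?thesis
        by eventually_elim (simp add: Tu)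
    qed
  qed
  obtain w :: "nat \<Rightarrow> 'a" where "\<And>i. norm (w i) = 1"
    "\<And>k a. 1/2 * (\<Sum>i<k. \<bar>a i\<bar>) \<le> norm (\<Sum>i<k. a i *\<^sub>R w i)"
    using ell1_sequence by blast
  then show ?thesis by (rule ell1_sequence_imp_isomorphic)
qed

theorem theorem4p8:
  fixes b :: "nat \<Rightarrow> 'a::banach"
  assumes "schauder_basis b"
  shows "\<exists>N::'a \<Rightarrow> real. equivalent_norm N \<and>
    ((\<exists>x y. block_basis b x \<and> normalized N x \<and> block_basis b y \<and> normalized N y \<and>
        iterated_limit (\<lambda>m n. N (x m + y n)) 2 \<and>
        iterated_limit (\<lambda>m n. N (x m - y n)) 2)
      \<longrightarrow> (\<exists>S::'a set. subspace S \<and> isomorphic_to_ell1 S))"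
proof -
  obtain c :: "nat \<Rightarrow> 'a" where dense: "\<And>x e. 0 < e \<Longrightarrow> \<exists>k. norm (x - c k) < e"
    using schauder_basis_separable[OF assms] by blast
  have "\<exists>S::'a set. subspace S \<and> isomorphic_to_ell1 S"
    if x: "normalized (os_sum c) x" and y: "normalized (os_sum c) y"
      and plus: "iterated_limit (\<lambda>m n. os_sum c (x m + y n)) 2"
      and minus: "iterated_limit (\<lambda>m n. os_sum c (x m - y n)) 2" for x y
  proof (rule asymp_additive_imp_ell1[OF dense])
    have N: "os_sum c (x n) = 1" "os_sum c (y n) = 1" "os_sum c (- y n) = 1" for n
      using x y by (simp_all add: normalized_def os_sum_def os_norm_minus)
    \<comment> \<open>Vectors normalized in the new norm are therefore nonzero, so
      \<open>sgn\<close> normalizes them in the original norm.\<close>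
    have "os_sum c 0 = 0" by (simp add: os_sum_def os_norm_def)
    with N have "x n \<noteq> 0" "y n \<noteq> 0" for n
      by (metis zero_neq_one)+
    then show "norm (sgn (x n)) = 1" "norm (sgn (y n)) = 1" for n
      by (simp_all add: norm_sgn)
    show "asymp_additive (\<lambda>m. sgn (x m)) (\<lambda>n. sgn (y n))"
      by (rule asymp_additive_os_sum[OF dense N(1,2) plus])
    show "asymp_additive (\<lambda>m. sgn (x m)) (\<lambda>n. - sgn (y n))"
      using asymp_additive_os_sum[OF dense N(1,3)] minus by (simp add: sgn_minus)
  qed
  then show ?thesis
    using equivalent_norm_os_sum[of c] by blast
qed

end
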